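(* For $\tau>0$ let $(\lambda(\tau),u(x,\tau))=\left(\frac{2\tau^2}{\cosh^2\tau},\,2\log\frac{\cosh\tau}{\cosh(\tau x)}\right)$ and let $\{\mu_j\}_{j=1}^{\infty}$, $\mu_1<\mu_2<\cdots$, be the eigenvalues (depending on $\tau$) of the problem $$\varphi''+\lambda(\tau)e^{u(x,\tau)}\varphi=-\mu\varphi\ \ (-1<x<1),\qquad \varphi(-1)=\varphi(1)=0.$$ Let $\tau_1$ be the unique positive solution of $\tau\tanh\tau=1$. Let $\varphi_1$ (for $\tau>\tau_1$) and $\varphi_j$ (for $j\ge2$, $\tau>0$) be the corresponding eigenfunctions, normalized as $$\varphi_1(x)=\sqrt{-\mu_1}\cosh(\sqrt{-\mu_1}\,x)-\tau\sinh(\sqrt{-\mu_1}\,x)\tanh(\tau x),$$ $$\varphi_j(x)=\sqrt{\frac{\mu_j}{\tau^2}+\tanh^2(\tau x)}\;\sin\left(\sqrt{\mu_j}\,x+\arctan\left(\frac{\tau\tanh(\tau x)}{\sqrt{\mu_j}}\right)+\frac{\pi}{2}j\right)\quad(j\ge2).$$ Then the following hold: (i) As $\tau\to\infty$, $$\frac1\tau\varphi_1\left(\frac y\tau\right)\to\frac{1}{\cosh y}\quad\text{in } C_{loc}(\mathbb{R}).$$ (ii) For every $j\ge2$, as $\tau\to\infty$, $$\varphi_j(x)\to\bar\varphi_j(x)\quad\text{in } C_{loc}([-1,0)\cup(0,1]),$$ where $$\bar\varphi_j(x):=\begin{cases}\sin\left(\frac{\pi}{2}(j-1)x+\frac{\pi}{2}(j+1)\right)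 & \text{if } 0<x\le1,\\[2pt] \sin\left(\frac{\pi}{2}(j-1)x+\frac{\pi}{2}(j-1)\right) & \text{if } -1\le x<0.\end{cases}$$
   Context: The pairs $(\lambda(\tau),u(\cdot,\tau))$, $\tau>0$, are exactly the positive solutions of the one-dimensional Gel'fand problem $u''+\lambda e^u=0$ on $(-1,1)$, $u(\pm1)=0$, with $\lambda>0$; the eigenvalue problem is its linearization at the solution. Primes denote derivatives in $x$. By classical Sturm–Liouville theory all eigenvalues are real and simple and can be listed as a strictly increasing sequence. The eigenvalues satisfy: for $j\ge2$ and all $\tau>0$, $\mu_j>0$ and $\tan\left(\sqrt{\mu_j}-\frac{\pi}{2}(j-1)\right)=\frac{\sqrt{\mu_j}}{\tau\tanh\tau}$ with $\frac{\pi}{2}(j-1)<\sqrt{\mu_j}<\frac{\pi}{2}j$; for $\tau>\tau_1$, $\mu_1<0$ is the unique negative solution of $\tanh\sqrt{-\mu_1}=\frac{\sqrt{-\mu_1}}{\tau\tanh\tau}$. Convergence in $C_{loc}(X)$ means uniform convergence on every compact subset of $X$. In (i), the explicit formula for $\varphi_1$ defines a function on all of $\mathbb{R}$ (and any given compact set of $y$ satisfies $y/\tau\in[-1,1]$ for large $\tau$). *)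

theory Defs
  imports "HOL-Analysis.Analysis"
begin

definition gelfand_lambda :: "real \<Rightarrow> real" where
  "gelfand_lambda \<tau> = 2 * \<tau>\<^sup>2 / (cosh \<tau>)\<^sup>2"

definition gelfand_u :: "real \<Rightarrow> real \<Rightarrow> real" where
  "gelfand_u x \<tau> = 2 * ln (cosh \<tau> / cosh (\<tau> * x))"

text \<open>Classical solutions: twice differentiable in the open interval and continuous up to the
  boundary (continuity of the second derivative follows from the equation).
  Eigenvalues and eigenfunctions are real, the problem being self-adjoint.\<close>

definition linearized_eigenfunction :: "real \<Rightarrow> real \<Rightarrow> (real \<Rightarrow> real) \<Rightarrow> bool" where
  "linearized_eigenfunction \<tau> m \<phi> \<longleftrightarrow>
     continuous_on {-1..1} \<phi> \<and>
     (\<exists>\<phi>' \<phi>''. \<forall>x\<in>{-1<..<1}.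
        (\<phi> has_real_derivative \<phi>' x) (at x) \<and>
        (\<phi>' has_real_derivative \<phi>'' x) (at x) \<and>
        \<phi>'' x + gelfand_lambda \<tau> * exp (gelfand_u x \<tau>) * \<phi> x = - m * \<phi> x) \<and>
     \<phi> (-1) = 0 \<and> \<phi> 1 = 0 \<and>
     (\<exists>x\<in>{-1..1}. \<phi> x \<noteq> 0)"

definition linearized_eigenvalue :: "real \<Rightarrow> real \<Rightarrow> bool" where
  "linearized_eigenvalue \<tau> m \<longleftrightarrow> (\<exists>\<phi>. linearized_eigenfunction \<tau> m \<phi>)"

text \<open>Indices start at 1; the value of the sequence at 0 is irrelevant. Since all eigenvalues
  are simple, listing them as a set loses no multiplicities.\<close>

definition increasing_eigenvalue_list :: "real \<Rightarrow> (nat \<Rightarrow> real) \<Rightarrow> bool" where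
  "increasing_eigenvalue_list \<tau> \<mu> \<longleftrightarrow>
     strict_mono_on {1..} \<mu> \<and> \<mu> ` {1..} = {m. linearized_eigenvalue \<tau> m}"

definition converges_C_loc ::
  "real set \<Rightarrow> (real \<Rightarrow> real \<Rightarrow> real) \<Rightarrow> (real \<Rightarrow> real) \<Rightarrow> real filter \<Rightarrow> bool" where
  "converges_C_loc X f g F \<longleftrightarrow> (\<forall>K. compact K \<and> K \<subseteq> X \<longrightarrow> uniform_limit K f g F)"

text \<open>Only the values on \<open>[-1,0) \<union> (0,1]\<close> are meaningful.\<close>

definition phi_bar :: "nat \<Rightarrow> real \<Rightarrow> real" where
  "phi_bar j x =
     (if 0 < x then sin (pi / 2 * (real j - 1) * x + pi / 2 * (real j + 1))
      else sin (pi / 2 * (real j - 1) * x + pi / 2 * (real j - 1)))"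

end

theory Submission imports Defs begin

text \<open>The weight \<open>\<lambda> e\<^sup>u\<close> equals \<open>2 \<tau>\<^sup>2 / cosh\<^sup>2 (\<tau> x)\<close>, a reflectionless potential: the first-order
  operator \<open>d/dx - \<tau> tanh (\<tau> x)\<close> carries solutions of \<open>\<psi>'' = - m \<psi>\<close> to solutions of the linearized
  equation with the same \<open>m\<close> (\<open>linearized_solution_darboux\<close>). This gives, for each real \<open>m\<close> other
  than \<open>- \<tau>\<^sup>2\<close>, an explicit even and an explicit odd solution that span all solutions, so \<open>m\<close> is an
  eigenvalue exactly when one of them vanishes at \<open>1\<close> (\<open>linearized_eigenvalue_iff_parity\<close>). The
  value \<open>m = - \<tau>\<^sup>2\<close>, where the operator annihilates \<open>cosh (\<tau> x)\<close>, has its own pair.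

  Put \<open>A = \<tau> tanh \<tau>\<close>. For \<open>m = k\<^sup>2\<close> the two boundary values are, up to nonzero factors, the sine and
  the cosine of \<open>k - arctan (k / A)\<close>, a strictly increasing function of \<open>k\<close> when \<open>A > 1\<close>; hence there
  is exactly one positive eigenvalue for each value \<open>n \<pi> / 2\<close> with \<open>n \<ge> 1\<close>. For \<open>m = - \<beta>\<^sup>2\<close> the condition is
  \<open>A tanh \<beta> = \<beta>\<close>, which has a single positive root, and this root is at least \<open>A / 2\<close> when \<open>A \<ge> 2\<close>; zero is not
  an eigenvalue. As \<open>A\<close> tends to infinity with \<open>\<tau>\<close>, this determines the whole increasing list for
  large \<open>\<tau>\<close> (\<open>eigenvalues_of_large_tau\<close>): the first entry is \<open>- \<beta>\<^sup>2\<close>, and the \<open>j\<close>-th one is \<open>k\<^sup>2\<close> with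
  \<open>k = \<pi> (j - 1) / 2 + arctan (k / A)\<close>.

  The limits follow. From \<open>\<beta> / \<tau> = tanh \<tau> tanh \<beta>\<close> and \<open>\<beta> \<ge> A / 2\<close> one gets \<open>\<beta> / \<tau> \<rightarrow> 1\<close>, and \<open>\<phi>\<^sub>1 (y / \<tau>) / \<tau>\<close>
  is a fixed jointly continuous function of \<open>(\<beta> / \<tau>, y)\<close> whose value at \<open>(1, y)\<close> is
  \<open>cosh y - sinh y tanh y = 1 / cosh y\<close>. For \<open>j \<ge> 2\<close> one gets \<open>k \<rightarrow> \<pi> (j - 1) / 2\<close>; away from \<open>x = 0\<close>,
  \<open>tanh (\<tau> x)\<close> tends to \<open>sgn x\<close> and the arctangent in the phase of \<open>\<phi>\<^sub>j\<close> to \<open>sgn x \<pi> / 2\<close>, both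
  uniformly, and this jump by \<open>\<pi>\<close> separates the two branches of the limit.\<close>

section \<open>The linearized equation and its explicit solutions\<close>

lemma one_minus_tanh_square: "1 - (tanh t)\<^sup>2 = 1 / (cosh t)\<^sup>2" for t :: real
proof -
  have "tanh t * cosh t = sinh t" by (simp add: tanh_def)
  moreover have "(1 - (tanh t)\<^sup>2) * (cosh t)\<^sup>2 = (cosh t)\<^sup>2 - (tanh t * cosh t)\<^sup>2"
    by (simp add: power_mult_distrib left_diff_distrib)
  ultimately have "(1 - (tanh t)\<^sup>2) * (cosh t)\<^sup>2 = 1"
    by (simp add: cosh_square_eq)
  then show ?thesis by (simp add: eq_divide_eq)
qed

lemma linearized_potential:
  "gelfand_lambda \<tau> * exp (gelfand_u x \<tau>) = 2 * \<tau>\<^sup>2 * (1 - (tanh (\<tau> * x))\<^sup>2)"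
proof -
  have pos: "cosh \<tau> / cosh (\<tau> * x) > 0"
    by simp
  have "exp (gelfand_u x \<tau>) = (cosh \<tau> / cosh (\<tau> * x))\<^sup>2"
    using pos exp_of_nat_mult[of 2 "ln (cosh \<tau> / cosh (\<tau> * x))"]
    by (simp add: gelfand_u_def)
  then show ?thesis
    by (simp add: gelfand_lambda_def one_minus_tanh_square power_divide)
qed

text \<open>The set \<open>X\<close> is a parameter because an eigenfunction solves the equation only in the open
  interval, whereas the explicit solutions do so on the whole line.\<close>

definition linearized_solution :: "real \<Rightarrow> real \<Rightarrow> (real \<Rightarrow> real) \<Rightarrow> (real \<Rightarrow> real) \<Rightarrow> real set \<Rightarrow> bool" where
  "linearized_solution \<tau> m f f' X \<longleftrightarrow>
     (\<forall>x\<in>X. (f has_real_derivative f' x) (at x) \<and>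
        (f' has_real_derivative - (m + 2 * \<tau>\<^sup>2 * (1 - (tanh (\<tau> * x))\<^sup>2)) * f x) (at x))"

lemma linearized_eigenfunction_iff:
  "linearized_eigenfunction \<tau> m f \<longleftrightarrow>
     continuous_on {-1..1} f \<and> (\<exists>f'. linearized_solution \<tau> m f f' {-1<..<1}) \<and>
     f (-1) = 0 \<and> f 1 = 0 \<and> (\<exists>x\<in>{-1..1}. f x \<noteq> 0)"
proof -
  have "(\<exists>f''. \<forall>x\<in>{-1<..<1}. (f has_real_derivative f' x) (at x) \<and>
        (f' has_real_derivative f'' x) (at x) \<and>
        f'' x + gelfand_lambda \<tau> * exp (gelfand_u x \<tau>) * f x = - m * f x) \<longleftrightarrow>
      linearized_solution \<tau> m f f' {-1<..<1}" (is "(\<exists>f''. ?P f'') \<longleftrightarrow> ?Q") for f'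
  proof
    assume "\<exists>f''. ?P f''"
    then obtain f'' where P: "?P f''" by blast
    have "f'' x = - (m + 2 * \<tau>\<^sup>2 * (1 - (tanh (\<tau> * x))\<^sup>2)) * f x" if "x \<in> {-1<..<1}" for x
    proof -
      have "f'' x + gelfand_lambda \<tau> * exp (gelfand_u x \<tau>) * f x = - m * f x"
        using P that by blast
      then show ?thesis
        unfolding linearized_potential by (simp add: algebra_simps)
    qed
    with P show ?Q
      unfolding linearized_solution_def by metis
  next
    assume ?Q
    then show "\<exists>f''. ?P f''"
      unfolding linearized_solution_def linearized_potential
      by (intro exI[of _ "\<lambda>x. - (m + 2 * \<tau>\<^sup>2 * (1 - (tanh (\<tau> * x))\<^sup>2)) * f x"])
        (simp add: algebra_simps)
  qed
  then show ?thesis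
    unfolding linearized_eigenfunction_def by simp
qed

text \<open>Writing \<open>w = \<tau> tanh (\<tau> x)\<close>, one has \<open>w' + w\<^sup>2 = \<tau>\<^sup>2\<close>. The operators \<open>- (d/dx)\<^sup>2 + \<tau>\<^sup>2\<close> and
  \<open>- (d/dx)\<^sup>2 + \<tau>\<^sup>2 - 2 w'\<close> are then \<open>B* B\<close> and \<open>B B*\<close> for \<open>B = d/dx - w\<close>, with \<open>B* = - d/dx - w\<close>, so \<open>B\<close>
  carries solutions of \<open>B* B \<psi> = c \<psi>\<close> to solutions of \<open>B B* \<phi> = c \<phi>\<close>: the Darboux transformation.\<close>

lemma linearized_solution_darboux:
  assumes "\<And>x. (\<psi> has_real_derivative \<psi>' x) (at x)"
    and "\<And>x. (\<psi>' has_real_derivative - m * \<psi> x) (at x)"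
  shows "linearized_solution \<tau> m (\<lambda>x. \<psi>' x - \<tau> * tanh (\<tau> * x) * \<psi> x)
    (\<lambda>x. - m * \<psi> x - \<tau>\<^sup>2 * (1 - (tanh (\<tau> * x))\<^sup>2) * \<psi> x - \<tau> * tanh (\<tau> * x) * \<psi>' x) X"
  unfolding linearized_solution_def
  by (auto intro!: derivative_eq_intros assms simp: algebra_simps power2_eq_square)

lemma wronskian_constant:
  assumes f: "linearized_solution \<tau> m f f' {a<..<b}"
    and g: "linearized_solution \<tau> m g g' {a<..<b}"
    and xy: "x \<in> {a<..<b}" "y \<in> {a<..<b}"
  shows "f x * g' x - f' x * g x = f y * g' y - f' y * g y"
proof -
  have "((\<lambda>x. f x * g' x - f' x * g x) has_real_derivative 0) (at z)" if z: "z \<in> {a<..<b}" for z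
  proof -
    define V where "V = m + 2 * \<tau>\<^sup>2 * (1 - (tanh (\<tau> * z))\<^sup>2)"
    have [derivative_intros]: "(f has_real_derivative f' z) (at z)" "(f' has_real_derivative - V * f z) (at z)"
      "(g has_real_derivative g' z) (at z)" "(g' has_real_derivative - V * g z) (at z)"
      using f g z by (auto simp: linearized_solution_def V_def)
    show ?thesis
      by (auto intro!: derivative_eq_intros)
  qed
  then show ?thesis
    using DERIV_isconst3[of a b x y "\<lambda>x. f x * g' x - f' x * g x"] xy
    by (metis (no_types, lifting) greaterThanLessThan_iff less_trans)
qed

text \<open>The Wronskian of \<open>p\<close> and \<open>q\<close> does not vanish, so constancy of the three Wronskians among \<open>f, p, q\<close>
  expresses any solution \<open>f\<close> as a combination \<open>a p + b q\<close>. By parity the conditions at \<open>1\<close> and \<open>-1\<close>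
  decouple into \<open>a p 1 = 0\<close> and \<open>b q 1 = 0\<close>. Since \<open>f'\<close> is given only in
  the open interval, the combination is found there and extended to the end points by continuity.\<close>

lemma linearized_eigenvalue_iff_parity:
  assumes p: "linearized_solution \<tau> m p p' UNIV" and q: "linearized_solution \<tau> m q q' UNIV"
    and even: "\<And>x. p (- x) = p x" and odd: "\<And>x. q (- x) = - q x"
    and p0: "p 0 \<noteq> 0" and q0: "q' 0 \<noteq> 0"
  shows "linearized_eigenvalue \<tau> m \<longleftrightarrow> p 1 = 0 \<or> q 1 = 0"
proof
  have sub: "linearized_solution \<tau> m f f' {-1<..<1}" if "linearized_solution \<tau> m f f' UNIV" for f f'
    using that by (simp add: linearized_solution_def)
  have cont: "continuous_on {-1..1} f" if "linearized_solution \<tau> m f f' UNIV" for f f'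
    using that unfolding linearized_solution_def
    by (intro DERIV_continuous_on[where D=f']) (auto intro: has_field_derivative_at_within)
  have q_0: "q 0 = 0" using odd[of 0] by simp
  {
    assume "linearized_eigenvalue \<tau> m"
    then obtain f f' where f: "continuous_on {-1..1} f" "linearized_solution \<tau> m f f' {-1<..<1}"
      "f (-1) = 0" "f 1 = 0" and nz: "\<exists>x\<in>{-1..1}. f x \<noteq> 0"
      unfolding linearized_eigenvalue_def linearized_eigenfunction_iff by blast
    define w where "w = p 0 * q' 0"
    define a where "a = (f 0 * q' 0 - f' 0 * q 0) / w"
    define b where "b = - (f 0 * p' 0 - f' 0 * p 0) / w"
    have w: "w \<noteq> 0" using p0 q0 by (simp add: w_def)
    have comb: "f x = a * p x + b * q x" if x: "x \<in> {-1<..<1}" for x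
    proof -
      have "p x * q' x - p' x * q x = w"
        using wronskian_constant[OF sub[OF p] sub[OF q] x, of 0] q_0 by (simp add: w_def)
      moreover have "f x * q' x - f' x * q x = w * a"
        using wronskian_constant[OF f(2) sub[OF q] x, of 0] w by (simp add: a_def)
      moreover have "f x * p' x - f' x * p x = - w * b"
        using wronskian_constant[OF f(2) sub[OF p] x, of 0] w by (simp add: b_def)
      \<comment> \<open>the determinant with rows \<open>(f, p, q)\<close>, \<open>(f, p, q)\<close>, \<open>(f', p', q')\<close> is zero\<close>
      moreover have "(p x * q' x - p' x * q x) * f x =
          (f x * q' x - f' x * q x) * p x - (f x * p' x - f' x * p x) * q x"
        by (simp add: algebra_simps)
      ultimately have "w * f x = w * a * p x - (- w * b) * q x"
        by metis
      then have "w * f x = w * (a * p x + b * q x)"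
        by (simp add: algebra_simps)
      then show ?thesis using w by simp
    qed
    have comb_closed: "f x = a * p x + b * q x" if x: "x \<in> {-1..1}" for x
    proof -
      have *: "continuous_on (closure {-1<..<1::real}) (\<lambda>x. f x - (a * p x + b * q x))"
        using f(1) cont[OF p] cont[OF q] by (auto intro!: continuous_intros)
      have "f x - (a * p x + b * q x) = 0"
        by (rule continuous_constant_on_closure[OF *]) (use comb x in auto)
      then show ?thesis by simp
    qed
    have "a * p 1 + b * q 1 = 0" "a * p 1 - b * q 1 = 0"
      using comb_closed[of 1] comb_closed[of "-1"] f(3,4) even[of 1] odd[of 1] by auto
    then have "a * p 1 = 0" "b * q 1 = 0" by auto
    moreover have "a \<noteq> 0 \<or> b \<noteq> 0"
      using nz comb_closed by auto
    ultimately show "p 1 = 0 \<or> q 1 = 0" by auto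
  }
  {
    assume "p 1 = 0 \<or> q 1 = 0"
    then show "linearized_eigenvalue \<tau> m"
    proof
      assume "p 1 = 0"
      then have "linearized_eigenfunction \<tau> m p"
        unfolding linearized_eigenfunction_iff
        using sub[OF p] cont[OF p] even[of 1] p0 by (auto intro!: bexI[of _ 0])
      then show ?thesis unfolding linearized_eigenvalue_def by blast
    next
      assume q1: "q 1 = 0"
      have "\<exists>x\<in>{-1..1}. q x \<noteq> 0"
      proof (rule ccontr)
        assume "\<not> (\<exists>x\<in>{-1..1}. q x \<noteq> 0)"
        then have "\<forall>y. \<bar>0 - y\<bar> < 1 \<longrightarrow> q 0 = q y" by (simp add: abs_less_iff)
        moreover have "(q has_real_derivative q' 0) (at 0)"
          using q by (simp add: linearized_solution_def)
        ultimately have "q' 0 = 0"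
          using DERIV_local_const[of q "q' 0" 0 1] by simp
        with q0 show False by simp
      qed
      then have "linearized_eigenfunction \<tau> m q"
        unfolding linearized_eigenfunction_iff
        using sub[OF q] cont[OF q] odd[of 1] q1 by auto
      then show ?thesis unfolding linearized_eigenvalue_def by blast
    qed
  }
qed

section \<open>The eigenvalue conditions\<close>

text \<open>The transformed functions come from \<open>\<psi> = sin (k x)\<close>, which gives the even solution, and
  \<open>\<psi> = cos (k x)\<close>, which gives the odd one.\<close>

lemma linearized_eigenvalue_positive_iff:
  assumes "0 < k" "0 < \<tau>"
  shows "linearized_eigenvalue \<tau> (k\<^sup>2) \<longleftrightarrow>
    k * cos k - \<tau> * tanh \<tau> * sin k = 0 \<or> k * sin k + \<tau> * tanh \<tau> * cos k = 0"
proof -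
  have p: "linearized_solution \<tau> (k\<^sup>2) (\<lambda>x. k * cos (k * x) - \<tau> * tanh (\<tau> * x) * sin (k * x))
    (\<lambda>x. - k\<^sup>2 * sin (k * x) - \<tau>\<^sup>2 * (1 - (tanh (\<tau> * x))\<^sup>2) * sin (k * x)
       - \<tau> * tanh (\<tau> * x) * (k * cos (k * x))) UNIV"
    by (rule linearized_solution_darboux)
      (auto intro!: derivative_eq_intros simp: power2_eq_square)
  have q: "linearized_solution \<tau> (k\<^sup>2) (\<lambda>x. - k * sin (k * x) - \<tau> * tanh (\<tau> * x) * cos (k * x))
    (\<lambda>x. - k\<^sup>2 * cos (k * x) - \<tau>\<^sup>2 * (1 - (tanh (\<tau> * x))\<^sup>2) * cos (k * x)
       - \<tau> * tanh (\<tau> * x) * (- k * sin (k * x))) UNIV"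
    by (rule linearized_solution_darboux)
      (auto intro!: derivative_eq_intros simp: power2_eq_square)
  have "k\<^sup>2 + \<tau>\<^sup>2 > 0" using assms by (simp add: add_pos_pos)
  then show ?thesis
    using linearized_eigenvalue_iff_parity[OF p q] assms by auto
qed

lemma not_linearized_eigenvalue_zero:
  assumes "0 < \<tau>" "\<tau> * tanh \<tau> \<noteq> 1"
  shows "\<not> linearized_eigenvalue \<tau> 0"
proof -
  have p: "linearized_solution \<tau> 0 (\<lambda>x. 1 - \<tau> * tanh (\<tau> * x) * x)
    (\<lambda>x. - 0 * x - \<tau>\<^sup>2 * (1 - (tanh (\<tau> * x))\<^sup>2) * x - \<tau> * tanh (\<tau> * x) * 1) UNIV"
    by (rule linearized_solution_darboux) (auto intro!: derivative_eq_intros)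
  have q: "linearized_solution \<tau> 0 (\<lambda>x. 0 - \<tau> * tanh (\<tau> * x) * 1)
    (\<lambda>x. - 0 * 1 - \<tau>\<^sup>2 * (1 - (tanh (\<tau> * x))\<^sup>2) * 1 - \<tau> * tanh (\<tau> * x) * 0) UNIV"
    by (rule linearized_solution_darboux) (auto intro!: derivative_eq_intros)
  show ?thesis
    using linearized_eigenvalue_iff_parity[OF p q] assms by auto
qed

text \<open>At \<open>m = - \<tau>\<^sup>2\<close> the transformation kills \<open>cosh (\<tau> x)\<close> and sends \<open>sinh (\<tau> x)\<close> to a multiple of
  \<open>1 / cosh (\<tau> x)\<close>. The odd solution \<open>q\<close> used here is a multiple of \<open>1 / cosh (\<tau> x)\<close> times the
  integral of \<open>cosh\<^sup>2 (\<tau> x)\<close>, as given by reduction of order. Neither solution vanishes at \<open>1\<close>.\<close>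

lemma not_linearized_eigenvalue_minus_tau_squared:
  assumes "0 < \<tau>"
  shows "\<not> linearized_eigenvalue \<tau> (- \<tau>\<^sup>2)"
proof -
  have [derivative_intros]: "((\<lambda>x. 1 / cosh (\<tau> * x)) has_real_derivative
      - \<tau> * tanh (\<tau> * x) * (1 / cosh (\<tau> * x))) (at x)" for x
    by (auto intro!: derivative_eq_intros simp: tanh_def)
  have p: "linearized_solution \<tau> (- \<tau>\<^sup>2) (\<lambda>x. 1 / cosh (\<tau> * x))
    (\<lambda>x. - \<tau> * tanh (\<tau> * x) * (1 / cosh (\<tau> * x))) UNIV"
    unfolding linearized_solution_def
    by (safe; (rule derivative_eq_intros refl | simp)+)
      (simp add: algebra_simps power2_eq_square diff_divide_distrib add_divide_distrib)
  have q: "linearized_solution \<tau> (- \<tau>\<^sup>2) (\<lambda>x. \<tau> * x * (1 / cosh (\<tau> * x)) + sinh (\<tau> * x))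
    (\<lambda>x. \<tau> * (1 / cosh (\<tau> * x)) + \<tau> * x * (- \<tau> * tanh (\<tau> * x) * (1 / cosh (\<tau> * x)))
       + \<tau> * cosh (\<tau> * x)) UNIV"
    unfolding linearized_solution_def
  proof (intro ballI conjI)
    fix x
    show "((\<lambda>x. \<tau> * x * (1 / cosh (\<tau> * x)) + sinh (\<tau> * x)) has_real_derivative
      \<tau> * (1 / cosh (\<tau> * x)) + \<tau> * x * (- \<tau> * tanh (\<tau> * x) * (1 / cosh (\<tau> * x)))
       + \<tau> * cosh (\<tau> * x)) (at x)"
      by (rule derivative_eq_intros refl | simp)+
    have tanh_sech: "tanh (\<tau> * x) * (1 / cosh (\<tau> * x)) = (1 - (tanh (\<tau> * x))\<^sup>2) * sinh (\<tau> * x)"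
      unfolding one_minus_tanh_square by (simp add: tanh_def power2_eq_square)
    have poly: "T * R = (1 - T\<^sup>2) * S \<Longrightarrow>
        2 * t * (- t * (T * R)) + t * x * (t\<^sup>2 * (2 * T\<^sup>2 - 1) * R) + t\<^sup>2 * S
        = - (- t\<^sup>2 + 2 * t\<^sup>2 * (1 - T\<^sup>2)) * (t * x * R + S)" for T R S t :: real
      by algebra
    have "((\<lambda>x. \<tau> * (1 / cosh (\<tau> * x)) + \<tau> * x * (- \<tau> * tanh (\<tau> * x) * (1 / cosh (\<tau> * x)))
       + \<tau> * cosh (\<tau> * x)) has_real_derivative
       2 * \<tau> * (- \<tau> * (tanh (\<tau> * x) * (1 / cosh (\<tau> * x))))
       + \<tau> * x * (\<tau>\<^sup>2 * (2 * (tanh (\<tau> * x))\<^sup>2 - 1) * (1 / cosh (\<tau> * x))) + \<tau>\<^sup>2 * sinh (\<tau> * x)) (at x)"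
      by (rule derivative_eq_intros refl | simp)+
        (simp add: algebra_simps power2_eq_square diff_divide_distrib add_divide_distrib)
    then show "((\<lambda>x. \<tau> * (1 / cosh (\<tau> * x)) + \<tau> * x * (- \<tau> * tanh (\<tau> * x) * (1 / cosh (\<tau> * x)))
       + \<tau> * cosh (\<tau> * x)) has_real_derivative
       - (- \<tau>\<^sup>2 + 2 * \<tau>\<^sup>2 * (1 - (tanh (\<tau> * x))\<^sup>2)) * (\<tau> * x * (1 / cosh (\<tau> * x)) + sinh (\<tau> * x))) (at x)"
      unfolding poly[OF tanh_sech] .
  qed
  have "\<tau> / cosh \<tau> + sinh \<tau> > 0"
    using assms by (simp add: add_pos_pos)
  then show ?thesis
    using linearized_eigenvalue_iff_parity[OF p q] assms by auto
qed

text \<open>The odd solution never contributes: it vanishes at \<open>1\<close> only if \<open>b tanh b = \<tau> tanh \<tau>\<close>, that is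
  \<open>b = \<tau>\<close>, which is the exceptional case treated separately.\<close>

lemma linearized_eigenvalue_negative_iff:
  assumes "0 < b" "0 < \<tau>"
  shows "linearized_eigenvalue \<tau> (- b\<^sup>2) \<longleftrightarrow> \<tau> * tanh \<tau> * tanh b = b"
proof (cases "b = \<tau>")
  case True
  have "tanh \<tau> * tanh \<tau> < 1 * 1"
    using assms by (intro mult_strict_mono tanh_real_lt_1) auto
  then show ?thesis
    using True not_linearized_eigenvalue_minus_tau_squared[OF assms(2)] assms by auto
next
  case False
  have p: "linearized_solution \<tau> (- b\<^sup>2) (\<lambda>x. b * cosh (b * x) - \<tau> * tanh (\<tau> * x) * sinh (b * x))
    (\<lambda>x. - (- b\<^sup>2) * sinh (b * x) - \<tau>\<^sup>2 * (1 - (tanh (\<tau> * x))\<^sup>2) * sinh (b * x)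
       - \<tau> * tanh (\<tau> * x) * (b * cosh (b * x))) UNIV"
    by (rule linearized_solution_darboux)
      (auto intro!: derivative_eq_intros simp: power2_eq_square)
  have q: "linearized_solution \<tau> (- b\<^sup>2) (\<lambda>x. b * sinh (b * x) - \<tau> * tanh (\<tau> * x) * cosh (b * x))
    (\<lambda>x. - (- b\<^sup>2) * cosh (b * x) - \<tau>\<^sup>2 * (1 - (tanh (\<tau> * x))\<^sup>2) * cosh (b * x)
       - \<tau> * tanh (\<tau> * x) * (b * sinh (b * x))) UNIV"
    by (rule linearized_solution_darboux)
      (auto intro!: derivative_eq_intros simp: power2_eq_square)
  have mono: "s * tanh s < t * tanh t" if "0 < s" "s < t" for s t :: real
    using that by (intro mult_strict_mono) auto
  have "b\<^sup>2 \<noteq> \<tau>\<^sup>2" using False assms by (simp add: power2_eq_iff)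
  then have "linearized_eigenvalue \<tau> (- b\<^sup>2) \<longleftrightarrow>
      b * cosh b - \<tau> * tanh \<tau> * sinh b = 0 \<or> b * sinh b - \<tau> * tanh \<tau> * cosh b = 0"
    using linearized_eigenvalue_iff_parity[OF p q] assms by auto
  moreover have "b * sinh b - \<tau> * tanh \<tau> * cosh b \<noteq> 0"
  proof
    assume "b * sinh b - \<tau> * tanh \<tau> * cosh b = 0"
    then have "b * tanh b = \<tau> * tanh \<tau>"
      by (simp add: tanh_def[of b] field_simps)
    then show False
      using mono[of b \<tau>] mono[of \<tau> b] False assms by linarith
  qed
  moreover have "b * cosh b - \<tau> * tanh \<tau> * sinh b = 0 \<longleftrightarrow> \<tau> * tanh \<tau> * tanh b = b"
    by (auto simp: tanh_def[of b] field_simps)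
  ultimately show ?thesis by simp
qed

section \<open>Counting the roots\<close>

text \<open>Setting \<open>\<theta> = arctan (k / A)\<close>, the vector \<open>(A, k)\<close> has polar angle \<open>\<theta>\<close>, and the boundary values of the
  even and the odd solution for \<open>m = k\<^sup>2\<close> are \<open>- r sin (k - \<theta>)\<close> and \<open>- r cos (k - \<theta>)\<close>.\<close>

definition phase_shift :: "real \<Rightarrow> real \<Rightarrow> real" where
  "phase_shift A k = k - arctan (k / A)"

lemma phase_shift_strict_mono:
  assumes "1 < A"
  shows "strict_mono (phase_shift A)"
proof (rule strict_monoI, rule DERIV_pos_imp_increasing, assumption)
  fix z
  have "inverse (1 + (z / A)\<^sup>2) \<le> 1"
    by (rule inverse_le_1_iff[THEN iffD2]) simp
  then have "inverse (1 + (z / A)\<^sup>2) * (1 / A) \<le> 1 / A"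
    using assms by (intro mult_left_le_one_le) auto
  also have "\<dots> < 1" using assms by simp
  finally have "inverse (1 + (z / A)\<^sup>2) * (1 / A) < 1" .
  moreover have "(phase_shift A has_real_derivative 1 - inverse (1 + (z / A)\<^sup>2) * (1 / A)) (at z)"
    unfolding phase_shift_def using assms by (auto intro!: derivative_eq_intros)
  ultimately show "\<exists>l. (phase_shift A has_real_derivative l) (at z) \<and> 0 < l"
    by force
qed

lemma linearized_eigenvalue_positive_iff_phase:
  assumes "0 < k" "0 < \<tau>"
  shows "linearized_eigenvalue \<tau> (k\<^sup>2) \<longleftrightarrow>
    (\<exists>i::int. phase_shift (\<tau> * tanh \<tau>) k = of_int i * (pi / 2))"
proof -
  define A where "A = \<tau> * tanh \<tau>"
  define \<theta> where "\<theta> = arctan (k / A)"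
  have A: "A > 0" using assms by (simp add: A_def)
  define r where "r = A * sqrt (1 + (k / A)\<^sup>2)"
  have sq: "sqrt (1 + (k / A)\<^sup>2) > 0" by (simp add: add_pos_nonneg)
  then have r: "r > 0" using A by (simp add: r_def)
  have k: "k = r * sin \<theta>" and A': "A = r * cos \<theta>"
    using A sq by (simp_all only: \<theta>_def r_def sin_arctan cos_arctan) (simp_all add: less_imp_neq[symmetric])
  have "k * cos k - A * sin k = - r * sin (k - \<theta>)"
    by (subst (1) k, subst A') (simp add: sin_diff algebra_simps)
  moreover have "k * sin k + A * cos k = r * cos (k - \<theta>)"
    by (subst (1) k, subst A') (simp add: cos_diff algebra_simps)
  ultimately have "linearized_eigenvalue \<tau> (k\<^sup>2) \<longleftrightarrow> sin (k - \<theta>) = 0 \<or> cos (k - \<theta>) = 0"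
    using linearized_eigenvalue_positive_iff[OF assms] r by (simp add: A_def)
  also have "\<dots> \<longleftrightarrow> sin (2 * (k - \<theta>)) = 0"
    by (simp only: sin_double) auto
  also have "\<dots> \<longleftrightarrow> (\<exists>i::int. k - \<theta> = of_int i * (pi / 2))"
    by (simp add: sin_zero_iff_int2 field_simps)
  finally show ?thesis
    by (simp add: phase_shift_def \<theta>_def A_def)
qed

text \<open>The arctangent lies strictly between \<open>0\<close> and \<open>\<pi> / 2\<close>, so the target value is crossed
  between \<open>n \<pi> / 2\<close> and \<open>(n + 1) \<pi> / 2\<close>.\<close>

lemma phase_shift_root:
  assumes "1 < A" "0 < n"
  obtains k where "pi / 2 * real n < k" "phase_shift A k = pi / 2 * real n"
proof -
  have "0 < arctan (pi / 2 * real n / A)" "arctan (pi / 2 * (real n + 1) / A) < pi / 2"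
    using assms by (simp, intro arctan_ubound)
  then have below: "phase_shift A (pi / 2 * real n) < pi / 2 * real n"
    and above: "pi / 2 * real n < phase_shift A (pi / 2 * (real n + 1))"
    by (auto simp: phase_shift_def algebra_simps)
  moreover have "continuous_on {pi / 2 * real n..pi / 2 * (real n + 1)} (phase_shift A)"
    using assms unfolding phase_shift_def by (auto intro!: continuous_intros)
  ultimately obtain k where k: "pi / 2 * real n \<le> k" "phase_shift A k = pi / 2 * real n"
    using IVT'[of "phase_shift A" "pi / 2 * real n" "pi / 2 * real n" "pi / 2 * (real n + 1)"]
    by (auto simp: algebra_simps)
  with below have "k \<noteq> pi / 2 * real n"
    using k(2) by (metis less_irrefl)
  with k show thesis by (intro that) auto
qed

text \<open>Together with the trivial zero at \<open>0\<close>, two positive zeros of \<open>A tanh x - x\<close> would yield two positive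
  critical points by Rolle's theorem; but \<open>A (1 - tanh\<^sup>2 x) = 1\<close> has at most one positive solution.\<close>

lemma tanh_root_unique:
  assumes "0 < b" "0 < c" "A * tanh b = b" "A * tanh c = c"
  shows "b = (c::real)"
proof -
  have False if "0 < s" "s < t" "A * tanh s = s" "A * tanh t = t" for s t :: real
  proof -
    let ?g = "\<lambda>x. A * tanh x - x"
    have D: "(?g has_real_derivative A * (1 - (tanh x)\<^sup>2) - 1) (at x)" for x
      by (auto intro!: derivative_eq_intros)
    have crit: "\<exists>z. x < z \<and> z < y \<and> A * (1 - (tanh z)\<^sup>2) = 1" if "x < y" "?g x = ?g y" for x y
    proof -
      have "\<exists>z. x < z \<and> z < y \<and> (\<lambda>v. (A * (1 - (tanh z)\<^sup>2) - 1) * v) = (\<lambda>v. 0)"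
        using that D
        by (intro Rolle_deriv[of x y ?g])
          (auto intro!: continuous_intros simp: has_field_derivative_def)
      then show ?thesis by (metis eq_iff_diff_eq_0 mult.right_neutral)
    qed
    have "?g 0 = ?g s" "?g s = ?g t" using that by auto
    then obtain z w where z: "0 < z" "z < s" "A * (1 - (tanh z)\<^sup>2) = 1"
      and w: "s < w" "w < t" "A * (1 - (tanh w)\<^sup>2) = 1"
      using crit[OF \<open>0 < s\<close>] crit[OF \<open>s < t\<close>] by blast
    have "A \<noteq> 0" using z(3) by auto
    moreover have "A * (tanh z)\<^sup>2 = A * (tanh w)\<^sup>2"
      using z(3) w(3) unfolding right_diff_distrib by linarith
    ultimately have "(tanh z)\<^sup>2 = (tanh w)\<^sup>2" by simp
    then have "tanh z = tanh w"
      using z(1) w(1) that(1) by (simp add: power2_eq_iff_nonneg)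
    then show False using z w by simp
  qed
  then show ?thesis using assms by (metis linorder_neqE)
qed

text \<open>The lower bound for the root is what forces it to infinity with \<open>A\<close>. It holds because
  \<open>tanh (A / 2) \<ge> tanh 1 > 1 / 2\<close>.\<close>

lemma tanh_root_exists:
  assumes "2 \<le> A"
  obtains b where "A / 2 \<le> b" "A * tanh b = (b::real)"
proof -
  have "3 < exp (2 :: real)"
    using exp_lower_Taylor_quadratic[of "2::real"] by simp
  then have "exp (- 2 :: real) < 1 / 3"
    by (simp add: exp_minus field_simps)
  moreover have "0 < 1 + exp (- 2 :: real)" by (simp add: add_pos_pos)
  ultimately have "1 / 2 < tanh (1::real)"
    unfolding tanh_real_altdef by (subst pos_less_divide_eq) auto
  also have "\<dots> \<le> tanh (A / 2)" using assms by simp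
  finally have "0 \<le> A * tanh (A / 2) - A / 2" using assms by (simp add: field_simps)
  moreover have "A * tanh A - A \<le> 0"
    using assms tanh_real_lt_1[of A] by (simp add: mult_left_le)
  moreover have "continuous_on {A / 2..A} (\<lambda>x. A * tanh x - x)"
    by (auto intro!: continuous_intros)
  ultimately obtain b where "A / 2 \<le> b" "A * tanh b - b = 0"
    using IVT2'[of "\<lambda>x. A * tanh x - x" A 0 "A / 2"] assms by auto
  then show thesis using that by simp
qed

text \<open>An element of the spectrum occupies the position that counts the eigenvalues not exceeding it,
  and this count does not depend on the list.\<close>

lemma increasing_eigenvalue_list_unique:
  assumes "increasing_eigenvalue_list \<tau> \<mu>" "increasing_eigenvalue_list \<tau> \<nu>" "1 \<le> j"
  shows "\<mu> j = \<nu> j"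
proof -
  define E where "E = {m. linearized_eigenvalue \<tau> m}"
  have card: "card {m\<in>E. m \<le> f i} = i"
    if f: "increasing_eigenvalue_list \<tau> f" and i: "1 \<le> i" for f i
  proof -
    have mono: "strict_mono_on {1..} f" and E: "E = f ` {1..}"
      using f by (auto simp: increasing_eigenvalue_list_def E_def)
    have "{m\<in>E. m \<le> f i} = f ` {1..i}"
    proof (intro equalityI subsetI)
      fix m assume "m \<in> {m \<in> E. m \<le> f i}"
      then obtain l where l: "1 \<le> l" "m = f l" "f l \<le> f i" by (auto simp: E)
      have "l \<le> i"
        using strict_mono_onD[OF mono, of i l] i l by force
      then show "m \<in> f ` {1..i}" using l by auto
    qed (use i strict_mono_on_leD[OF mono] in \<open>auto simp: E\<close>)
    moreover have "inj_on f {1..i}"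
      using strict_mono_on_imp_inj_on[OF mono] by (rule inj_on_subset) auto
    ultimately show ?thesis by (simp add: card_image)
  qed
  have "\<mu> j \<in> \<mu> ` {1..}" using assms(3) by simp
  also have "\<dots> = \<nu> ` {1..}"
    using assms(1,2) by (simp add: increasing_eigenvalue_list_def)
  finally obtain i where i: "1 \<le> i" "\<mu> j = \<nu> i" by auto
  with card[OF assms(1,3)] card[OF assms(2) i(1)] show ?thesis by simp
qed

text \<open>The roots found above are assembled into an increasing list of all eigenvalues; by uniqueness of
  such lists it is the given one. The shift from \<open>n\<close> to \<open>j - 1\<close> comes from the single
  negative eigenvalue.\<close>

lemma eigenvalues_of_large_tau:
  assumes \<tau>: "0 < \<tau>" "2 \<le> \<tau> * tanh \<tau>" and \<mu>: "increasing_eigenvalue_list \<tau> \<mu>"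
  shows "\<exists>b. \<mu> 1 = - b\<^sup>2 \<and> \<tau> * tanh \<tau> / 2 \<le> b \<and> \<tau> * tanh \<tau> * tanh b = b"
    and "2 \<le> j \<Longrightarrow> \<exists>k>pi / 2 * (real j - 1). \<mu> j = k\<^sup>2 \<and>
      k - arctan (k / (\<tau> * tanh \<tau>)) = pi / 2 * (real j - 1)"
proof -
  define A where "A = \<tau> * tanh \<tau>"
  have A: "2 \<le> A" using \<tau> by (simp add: A_def)
  have A_gt: "1 < A" using A by simp
  note mono = phase_shift_strict_mono[OF A_gt]
  obtain b where b: "A / 2 \<le> b" "A * tanh b = b"
    using tanh_root_exists A by blast
  have "\<forall>n. \<exists>k. 0 < n \<longrightarrow> pi / 2 * real n < k \<and> phase_shift A k = pi / 2 * real n"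
    using phase_shift_root[OF A_gt] by metis
  then obtain k where k: "\<And>n. 0 < n \<Longrightarrow> pi / 2 * real n < k n"
    "\<And>n. 0 < n \<Longrightarrow> phase_shift A (k n) = pi / 2 * real n"
    by metis
  have k_pos: "0 < k n" if "0 < n" for n
    by (rule le_less_trans[OF _ k(1)[OF that]]) simp
  have k_mono: "k m < k n" if "0 < m" "m < n" for m n
  proof -
    have "phase_shift A (k m) < phase_shift A (k n)"
    proof -
      have "pi / 2 * real m < pi / 2 * real n"
        using that by (intro mult_strict_left_mono) auto
      then show ?thesis using k(2)[of m] k(2)[of n] that by linarith
    qed
    then show ?thesis using strict_mono_less[OF mono] by blast
  qed
  define \<nu> where "\<nu> j = (if j \<le> 1 then - b\<^sup>2 else (k (j - 1))\<^sup>2)" for j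
  have neg: "linearized_eigenvalue \<tau> m \<longleftrightarrow> m = - b\<^sup>2" if "m < 0" for m
  proof -
    define c where "c = sqrt (- m)"
    have c: "0 < c" "m = - c\<^sup>2" using that by (auto simp: c_def)
    have "linearized_eigenvalue \<tau> m \<longleftrightarrow> A * tanh c = c"
      using linearized_eigenvalue_negative_iff[OF c(1) \<tau>(1)] c(2) by (simp add: A_def)
    also have "\<dots> \<longleftrightarrow> c = b"
      using tanh_root_unique[of c b A] b c A by auto
    finally show ?thesis using c b A by auto
  qed
  have zero: "\<not> linearized_eigenvalue \<tau> 0"
    using not_linearized_eigenvalue_zero[OF \<tau>(1)] \<tau>(2) by auto
  have pos: "linearized_eigenvalue \<tau> m \<longleftrightarrow> (\<exists>n>0. m = (k n)\<^sup>2)" if "0 < m" for m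
  proof -
    define c where "c = sqrt m"
    have c: "0 < c" "m = c\<^sup>2" using that by (auto simp: c_def)
    have "linearized_eigenvalue \<tau> m \<longleftrightarrow> (\<exists>i::int. phase_shift A c = of_int i * (pi / 2))"
      using linearized_eigenvalue_positive_iff_phase[OF c(1) \<tau>(1)] c(2) by (simp add: A_def)
    also have "\<dots> \<longleftrightarrow> (\<exists>n>0. phase_shift A c = pi / 2 * real n)"
    proof
      assume "\<exists>i::int. phase_shift A c = of_int i * (pi / 2)"
      then obtain i :: int where i: "phase_shift A c = of_int i * (pi / 2)" by blast
      moreover have "0 < phase_shift A c"
        using strict_monoD[OF mono c(1)] by (simp add: phase_shift_def)
      ultimately have "0 < of_int i * (pi / 2)" by simp
      then have "0 < i" using pi_half_gt_zero by (simp only: zero_less_mult_iff of_int_0_less_iff) linarith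
      with i show "\<exists>n>0. phase_shift A c = pi / 2 * real n"
        by (intro exI[of _ "nat i"]) auto
    next
      assume "\<exists>n>0. phase_shift A c = pi / 2 * real n"
      then show "\<exists>i::int. phase_shift A c = of_int i * (pi / 2)"
        by (metis mult.commute of_int_of_nat_eq)
    qed
    also have "\<dots> \<longleftrightarrow> (\<exists>n>0. c = k n)"
      using k(2) strict_mono_eq[OF mono] by metis
    also have "\<dots> \<longleftrightarrow> (\<exists>n>0. m = (k n)\<^sup>2)"
      using c k_pos by (intro ex_cong1 conj_cong refl) (simp add: power2_eq_iff_nonneg less_imp_le)
    finally show ?thesis .
  qed
  have "increasing_eigenvalue_list \<tau> \<nu>"
    unfolding increasing_eigenvalue_list_def
  proof
    show "strict_mono_on {1..} \<nu>"
    proof (rule strict_mono_onI)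
      fix i j :: nat assume ij: "i \<in> {1..}" "i < j"
      show "\<nu> i < \<nu> j"
      proof (cases "i = 1")
        case True
        have "- b\<^sup>2 \<le> 0" "0 < (k (j - 1))\<^sup>2" using k_pos[of "j - 1"] ij by auto
        then have "- b\<^sup>2 < (k (j - 1))\<^sup>2" by linarith
        then show ?thesis using True ij by (simp add: \<nu>_def)
      next
        case False
        then show ?thesis using ij k_pos[of "i - 1"] k_mono[of "i - 1" "j - 1"]
          by (auto simp: \<nu>_def intro!: power_strict_mono)
      qed
    qed
    show "\<nu> ` {1..} = {m. linearized_eigenvalue \<tau> m}"
    proof (intro equalityI subsetI)
      fix m assume "m \<in> \<nu> ` {1..}"
      then obtain j where j: "1 \<le> j" "m = \<nu> j" by auto
      show "m \<in> {m. linearized_eigenvalue \<tau> m}"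
      proof (cases "j = 1")
        case True
        then show ?thesis using j neg[of m] b A by (auto simp: \<nu>_def)
      next
        case False
        then have "0 < j - 1" "m = (k (j - 1))\<^sup>2" using j by (auto simp: \<nu>_def)
        moreover from this have "0 < m" using k_pos[of "j - 1"] by (metis zero_less_power)
        ultimately show ?thesis using pos by blast
      qed
    next
      fix m assume "m \<in> {m. linearized_eigenvalue \<tau> m}"
      then consider "m = - b\<^sup>2" | n where "0 < n" "m = (k n)\<^sup>2"
        using neg[of m] pos[of m] zero by (cases m "0::real" rule: linorder_cases) auto
      then show "m \<in> \<nu> ` {1..}"
      proof cases
        case 1 then show ?thesis by (intro image_eqI[of _ _ 1]) (auto simp: \<nu>_def)
      next
        case 2 then show ?thesis by (intro image_eqI[of _ _ "Suc n"]) (auto simp: \<nu>_def)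
      qed
    qed
  qed
  note \<mu>_eq = increasing_eigenvalue_list_unique[OF \<mu> this]
  show "\<exists>b. \<mu> 1 = - b\<^sup>2 \<and> \<tau> * tanh \<tau> / 2 \<le> b \<and> \<tau> * tanh \<tau> * tanh b = b"
    using \<mu>_eq[of 1] b by (auto simp: \<nu>_def A_def)
  show "\<exists>k>pi / 2 * (real j - 1). \<mu> j = k\<^sup>2 \<and>
      k - arctan (k / (\<tau> * tanh \<tau>)) = pi / 2 * (real j - 1)" if "2 \<le> j"
    using \<mu>_eq[of j] k[of "j - 1"] that
    by (intro exI[of _ "k (j - 1)"]) (auto simp: \<nu>_def A_def phase_shift_def of_nat_diff)
qed

section \<open>Limits of the eigenfunctions\<close>

lemma uniform_limit_jointly_continuous:
  fixes f :: "'a::topological_space \<times> 'b::topological_space \<Rightarrow> 'c::metric_space"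
  assumes "continuous_on (UNIV \<times> K) f" "compact K" "(s \<longlongrightarrow> s0) F"
  shows "uniform_limit K (\<lambda>t x. f (s t, x)) (\<lambda>x. f (s0, x)) F"
proof (rule uniform_limitI)
  fix e :: real assume "0 < e"
  then obtain U where U: "s0 \<in> U" "open U"
    "\<forall>t\<in>U \<inter> UNIV. \<forall>x\<in>K. dist (f (t, x)) (f (s0, x)) \<le> e / 2"
    using continuous_on_prod_compactE[OF assms(1,2), of s0 "e / 2"] by auto
  have "\<forall>\<^sub>F t in F. s t \<in> U"
    using topological_tendstoD[OF assms(3) U(2,1)] .
  then show "\<forall>\<^sub>F t in F. \<forall>x\<in>K. dist (f (s t, x)) (f (s0, x)) < e"
    by eventually_elim (use U(3) \<open>0 < e\<close> in force)
qed

lemma filterlim_tau_tanh_tau: "filterlim (\<lambda>\<tau>::real. \<tau> * tanh \<tau>) at_top at_top"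
  by (rule filterlim_at_top_mult_tendsto_pos[OF tanh_real_at_top _ filterlim_ident, simplified mult.commute]) simp

text \<open>Multiplying the root equation by \<open>1 / \<tau>\<close> gives \<open>b / \<tau> = tanh \<tau> tanh b\<close>, and \<open>b \<rightarrow> \<infinity>\<close> by the lower
  bound, so \<open>b / \<tau> \<rightarrow> 1\<close>.\<close>

lemma phi_1_limit:
  fixes b :: "real \<Rightarrow> real"
  assumes "\<forall>\<^sub>F \<tau> in at_top. \<tau> * tanh \<tau> / 2 \<le> b \<tau>"
    and "\<forall>\<^sub>F \<tau> in at_top. \<tau> * tanh \<tau> * tanh (b \<tau>) = b \<tau>"
    and "\<forall>\<^sub>F \<tau> in at_top. \<forall>x. \<phi> \<tau> x = b \<tau> * cosh (b \<tau> * x) - \<tau> * sinh (b \<tau> * x) * tanh (\<tau> * x)"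
  shows "converges_C_loc UNIV (\<lambda>\<tau> y. 1 / \<tau> * \<phi> \<tau> (y / \<tau>)) (\<lambda>y. 1 / cosh y) at_top"
  unfolding converges_C_loc_def
proof safe
  fix K :: "real set" assume K: "compact K"
  have "filterlim (\<lambda>\<tau>::real. \<tau> * tanh \<tau> / 2) at_top at_top"
    using filterlim_tendsto_pos_mult_at_top[OF tendsto_const[of "1 / 2"] _ filterlim_tau_tanh_tau]
    by (simp add: mult.commute)
  then have "filterlim b at_top at_top"
    using assms(1) by (rule filterlim_at_top_mono)
  then have "((\<lambda>\<tau>. tanh (b \<tau>)) \<longlongrightarrow> 1) at_top"
    by (rule filterlim_compose[OF tanh_real_at_top])
  then have "((\<lambda>\<tau>. tanh \<tau> * tanh (b \<tau>)) \<longlongrightarrow> 1) at_top"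
    using tendsto_mult[OF tanh_real_at_top, of _ 1] by simp
  moreover have "\<forall>\<^sub>F \<tau> in at_top. tanh \<tau> * tanh (b \<tau>) = b \<tau> / \<tau>"
    using assms(2) eventually_gt_at_top[of 0] by eventually_elim (simp add: field_simps)
  ultimately have lim: "((\<lambda>\<tau>. b \<tau> / \<tau>) \<longlongrightarrow> 1) at_top"
    by (simp add: tendsto_cong)
  define f where "f = (\<lambda>(s, y). s * cosh (s * y) - sinh (s * y) * tanh y :: real)"
  have "continuous_on (UNIV \<times> K) f"
    unfolding f_def case_prod_unfold by (intro continuous_intros) auto
  from uniform_limit_jointly_continuous[OF this K lim]
  have "uniform_limit K (\<lambda>\<tau> y. f (b \<tau> / \<tau>, y)) (\<lambda>y. f (1, y)) at_top" .
  moreover have "f (1, y) = 1 / cosh y" for y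
  proof -
    have "f (1, y) = cosh y * (1 - (tanh y)\<^sup>2)"
      by (simp add: f_def tanh_def power2_eq_square right_diff_distrib)
    then show ?thesis
      unfolding one_minus_tanh_square by (simp add: power2_eq_square)
  qed
  moreover have "\<forall>\<^sub>F \<tau> in at_top. \<forall>y\<in>K. f (b \<tau> / \<tau>, y) = 1 / \<tau> * \<phi> \<tau> (y / \<tau>)"
    using assms(3) eventually_gt_at_top[of 0]
  proof eventually_elim
    case (elim \<tau>)
    show ?case
    proof
      fix y
      have "\<phi> \<tau> (y / \<tau>) = b \<tau> * cosh (b \<tau> / \<tau> * y) - \<tau> * (sinh (b \<tau> / \<tau> * y) * tanh y)"
        using elim by (simp add: mult.assoc)
      then show "f (b \<tau> / \<tau>, y) = 1 / \<tau> * \<phi> \<tau> (y / \<tau>)"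
        using elim(2) by (simp add: f_def right_diff_distrib)
    qed
  qed
  ultimately show "uniform_limit K (\<lambda>\<tau> y. 1 / \<tau> * \<phi> \<tau> (y / \<tau>)) (\<lambda>y. 1 / cosh y) at_top"
    using uniform_limit_cong[of K "\<lambda>\<tau> y. f (b \<tau> / \<tau>, y)" "\<lambda>\<tau> y. 1 / \<tau> * \<phi> \<tau> (y / \<tau>)" at_top
      "\<lambda>y. f (1, y)" "\<lambda>y. 1 / cosh y"] by simp
qed

text \<open>Measuring the amplitude error by \<open>r\<^sup>2 - 1\<close> instead of \<open>r - 1\<close> removes the square root from the
  amplitude of \<open>\<phi>\<^sub>j\<close>.\<close>

lemma abs_mult_sin_diff_le:
  fixes a b r :: real
  assumes "0 \<le> r"
  shows "\<bar>r * sin a - sin b\<bar> \<le> \<bar>r\<^sup>2 - 1\<bar> + \<bar>a - b\<bar>"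
proof -
  have "\<bar>r - 1\<bar> * 1 \<le> \<bar>r - 1\<bar> * \<bar>r + 1\<bar>"
    using assms by (intro mult_left_mono) auto
  also have "\<dots> = \<bar>r\<^sup>2 - 1\<bar>"
    by (simp add: abs_mult[symmetric] power2_eq_square algebra_simps)
  finally have r: "\<bar>r - 1\<bar> \<le> \<bar>r\<^sup>2 - 1\<bar>" by simp
  have "\<bar>sin a - sin b\<bar> = 2 * \<bar>sin ((a - b) / 2)\<bar> * \<bar>cos ((a + b) / 2)\<bar>"
    by (simp add: sin_diff_sin abs_mult)
  also have "\<dots> \<le> 2 * \<bar>(a - b) / 2\<bar> * 1"
    by (intro mult_mono abs_sin_x_le_abs_x abs_cos_le_one) auto
  finally have s: "\<bar>sin a - sin b\<bar> \<le> \<bar>a - b\<bar>" by simp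
  have "\<bar>r * sin a - sin b\<bar> = \<bar>(r - 1) * sin a + (sin a - sin b)\<bar>"
    by (simp add: algebra_simps)
  also have "\<dots> \<le> \<bar>r - 1\<bar> * \<bar>sin a\<bar> + \<bar>sin a - sin b\<bar>"
    by (metis abs_mult abs_triangle_ineq)
  also have "\<dots> \<le> \<bar>r - 1\<bar> * 1 + \<bar>a - b\<bar>"
    using s by (intro add_mono mult_left_mono) auto
  finally show ?thesis using r by simp
qed

text \<open>The amplitude and the phase are compared with \<open>1\<close> and \<open>\<kappa> x + sgn x (\<pi> / 2) + c\<close> separately. As
  \<open>tanh\<close> and \<open>arctan\<close> are odd and increasing, the worst case over \<open>\<delta> \<le> \<bar>x\<bar>\<close> occurs at \<open>\<bar>x\<bar> = \<delta>\<close>, which makes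
  the bound independent of \<open>x\<close>.\<close>

lemma phi_j_deviation:
  fixes k \<kappa> \<tau> \<delta> x c :: real
  assumes "0 < k" "0 < \<tau>" "0 < \<delta>" "\<delta> \<le> \<bar>x\<bar>" "\<bar>x\<bar> \<le> 1"
  shows "\<bar>sqrt (k\<^sup>2 / \<tau>\<^sup>2 + (tanh (\<tau> * x))\<^sup>2) * sin (k * x + arctan (\<tau> * tanh (\<tau> * x) / k) + c)
      - sin (\<kappa> * x + sgn x * (pi / 2) + c)\<bar>
    \<le> k\<^sup>2 / \<tau>\<^sup>2 + (1 - (tanh (\<tau> * \<delta>))\<^sup>2) + \<bar>k - \<kappa>\<bar> + (pi / 2 - arctan (\<tau> * tanh (\<tau> * \<delta>) / k))"
proof -
  define T where "T = tanh (\<tau> * \<bar>x\<bar>)"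
  have T: "tanh (\<tau> * \<delta>) \<le> T" "0 \<le> tanh (\<tau> * \<delta>)" "T \<le> 1"
    using assms by (auto simp: T_def tanh_real_lt_1 less_imp_le)
  have sgn: "sgn x = 1 \<or> sgn x = - 1" using assms by (auto simp: sgn_if)
  have tanh: "tanh (\<tau> * x) = sgn x * T"
    using assms by (auto simp: T_def sgn_if abs_if)
  have "(tanh (\<tau> * \<delta>))\<^sup>2 \<le> T\<^sup>2" "T\<^sup>2 \<le> 1"
    using T by (intro power_mono power_le_one; linarith)+
  moreover have "(tanh (\<tau> * x))\<^sup>2 = T\<^sup>2" using sgn tanh by auto
  ultimately have amp: "\<bar>(sqrt (k\<^sup>2 / \<tau>\<^sup>2 + (tanh (\<tau> * x))\<^sup>2))\<^sup>2 - 1\<bar>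
      \<le> k\<^sup>2 / \<tau>\<^sup>2 + (1 - (tanh (\<tau> * \<delta>))\<^sup>2)"
    by (simp add: abs_le_iff)  (smt (verit) zero_le_power2 divide_nonneg_nonneg)
  have "arctan (\<tau> * tanh (\<tau> * x) / k) = sgn x * arctan (\<tau> * T / k)"
    using sgn by (auto simp: tanh arctan_minus)
  then have "\<bar>(k * x + arctan (\<tau> * tanh (\<tau> * x) / k) + c) - (\<kappa> * x + sgn x * (pi / 2) + c)\<bar>
      = \<bar>(k - \<kappa>) * x - sgn x * (pi / 2 - arctan (\<tau> * T / k))\<bar>"
    by (simp add: algebra_simps)
  also have "\<dots> \<le> \<bar>(k - \<kappa>) * x\<bar> + \<bar>sgn x * (pi / 2 - arctan (\<tau> * T / k))\<bar>"
    by (rule abs_triangle_ineq4)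
  also have "\<bar>(k - \<kappa>) * x\<bar> \<le> \<bar>k - \<kappa>\<bar>"
    using assms by (simp add: abs_mult mult_left_le)
  also have "\<bar>sgn x * (pi / 2 - arctan (\<tau> * T / k))\<bar> = pi / 2 - arctan (\<tau> * T / k)"
    using sgn arctan_ubound[of "\<tau> * T / k"] by (auto simp: abs_mult)
  also have "\<dots> \<le> pi / 2 - arctan (\<tau> * tanh (\<tau> * \<delta>) / k)"
    using T assms by (simp add: arctan_le_iff divide_right_mono mult_left_mono)
  finally have phase: "\<bar>(k * x + arctan (\<tau> * tanh (\<tau> * x) / k) + c) - (\<kappa> * x + sgn x * (pi / 2) + c)\<bar>
      \<le> \<bar>k - \<kappa>\<bar> + (pi / 2 - arctan (\<tau> * tanh (\<tau> * \<delta>) / k))" by simp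
  show ?thesis
    using abs_mult_sin_diff_le[of "sqrt (k\<^sup>2 / \<tau>\<^sup>2 + (tanh (\<tau> * x))\<^sup>2)"
        "k * x + arctan (\<tau> * tanh (\<tau> * x) / k) + c" "\<kappa> * x + sgn x * (pi / 2) + c"] amp phase
    by (simp add: add_nonneg_nonneg)
qed

lemma compact_punctured_interval_away_from_zero:
  fixes K :: "real set"
  assumes "compact K" "K \<subseteq> {-1..<0} \<union> {0<..1}"
  obtains \<delta> where "0 < \<delta>" "\<And>x. x \<in> K \<Longrightarrow> \<delta> \<le> \<bar>x\<bar>"
  using separate_point_closed[OF compact_imp_closed[OF assms(1)], of 0] assms(2)
  by (force simp: dist_real_def)

lemma phi_j_limit:
  fixes k :: "real \<Rightarrow> real"
  assumes lim: "(k \<longlongrightarrow> pi / 2 * (real j - 1)) at_top" and j: "2 \<le> j"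
    and \<phi>: "\<forall>\<^sub>F \<tau> in at_top. \<forall>x\<in>{-1..1}. \<phi> \<tau> x = sqrt ((k \<tau>)\<^sup>2 / \<tau>\<^sup>2 + (tanh (\<tau> * x))\<^sup>2) *
        sin (k \<tau> * x + arctan (\<tau> * tanh (\<tau> * x) / k \<tau>) + pi / 2 * real j)"
  shows "converges_C_loc ({-1..<0} \<union> {0<..1}) \<phi> (phi_bar j) at_top"
  unfolding converges_C_loc_def
proof safe
  fix K :: "real set" assume K: "compact K" "K \<subseteq> {-1..<0} \<union> {0<..1}"
  obtain \<delta> where \<delta>: "0 < \<delta>" "\<And>x. x \<in> K \<Longrightarrow> \<delta> \<le> \<bar>x\<bar>"
    using compact_punctured_interval_away_from_zero[OF K] by blast
  define \<kappa> where "\<kappa> = pi / 2 * (real j - 1)"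
  have \<kappa>: "0 < \<kappa>" using j by (simp add: \<kappa>_def)
  have lim: "(k \<longlongrightarrow> \<kappa>) at_top" using lim by (simp add: \<kappa>_def)
  have tanh: "((\<lambda>\<tau>. tanh (\<tau> * \<delta>)) \<longlongrightarrow> 1) at_top"
    by (rule filterlim_compose[OF tanh_real_at_top filterlim_at_top_mult_tendsto_pos[OF tendsto_const \<delta>(1) filterlim_ident]])
  define B where "B \<tau> = (k \<tau>)\<^sup>2 / \<tau>\<^sup>2 + (1 - (tanh (\<tau> * \<delta>))\<^sup>2) + \<bar>k \<tau> - \<kappa>\<bar>
    + (pi / 2 - arctan (\<tau> * tanh (\<tau> * \<delta>) / k \<tau>))" for \<tau>
  have "filterlim (\<lambda>\<tau>. tanh (\<tau> * \<delta>) / k \<tau> * \<tau>) at_top at_top"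
    using tendsto_divide[OF tanh lim] \<kappa>
    by (intro filterlim_tendsto_pos_mult_at_top[where c="1 / \<kappa>"] filterlim_ident) auto
  then have "((\<lambda>\<tau>. arctan (\<tau> * tanh (\<tau> * \<delta>) / k \<tau>)) \<longlongrightarrow> pi / 2) at_top"
    using filterlim_compose[OF tendsto_arctan_at_top] by (fastforce simp: mult.commute)
  moreover have "((\<lambda>\<tau>. (k \<tau>)\<^sup>2 / \<tau>\<^sup>2) \<longlongrightarrow> 0) at_top"
    by (rule real_tendsto_divide_at_top[OF tendsto_power[OF lim] filterlim_pow_at_top[OF _ filterlim_ident]]) simp
  ultimately have "(B \<longlongrightarrow> 0 + (1 - 1\<^sup>2) + \<bar>\<kappa> - \<kappa>\<bar> + (pi / 2 - pi / 2)) at_top"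
    unfolding B_def by (intro tendsto_intros tanh lim)
  then have B: "(B \<longlongrightarrow> 0) at_top" by simp
  show "uniform_limit K \<phi> (phi_bar j) at_top"
  proof (rule uniform_limitI)
    fix e :: real assume "0 < e"
    then have "\<forall>\<^sub>F \<tau> in at_top. B \<tau> < e" by (rule order_tendstoD(2)[OF B])
    moreover have "\<forall>\<^sub>F \<tau> in at_top. 0 < k \<tau>" by (rule order_tendstoD(1)[OF lim \<kappa>])
    ultimately show "\<forall>\<^sub>F \<tau> in at_top. \<forall>x\<in>K. dist (\<phi> \<tau> x) (phi_bar j x) < e"
      using \<phi> eventually_gt_at_top[of "0::real"]
    proof eventually_elim
      case (elim \<tau>)
      show ?case
      proof
        fix x assume x: "x \<in> K"
        then have x': "x \<in> {-1..1}" "x \<noteq> 0" "\<bar>x\<bar> \<le> 1" using K(2) by force+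
        have "phi_bar j x = sin (\<kappa> * x + sgn x * (pi / 2) + pi / 2 * real j)"
        proof (cases "0 < x")
          case True
          then show ?thesis
            unfolding phi_bar_def \<kappa>_def by (simp add: distrib_left add_divide_distrib add_ac)
        next
          case False
          then have "sgn x = - 1" using x'(2) by simp
          with False show ?thesis
            unfolding phi_bar_def \<kappa>_def
            by (simp add: right_diff_distrib diff_divide_distrib algebra_simps)
        qed
        then have "dist (\<phi> \<tau> x) (phi_bar j x) \<le> B \<tau>"
          using phi_j_deviation[OF elim(2) elim(4) \<delta>(1) \<delta>(2)[OF x] x'(3)] elim(3) x'(1)
          by (simp add: dist_real_def B_def)
        then show "dist (\<phi> \<tau> x) (phi_bar j x) < e" using elim(1) by simp
      qed
    qed
  qed
qed

theorem corollary1p4: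
  fixes \<tau>\<^sub>1 :: real
    and \<mu> :: "real \<Rightarrow> nat \<Rightarrow> real"
    and \<phi> :: "real \<Rightarrow> nat \<Rightarrow> real \<Rightarrow> real"
  assumes tau1: "0 < \<tau>\<^sub>1" "\<tau>\<^sub>1 * tanh \<tau>\<^sub>1 = 1"
    and eigenvalues: "\<And>\<tau>. 0 < \<tau> \<Longrightarrow> increasing_eigenvalue_list \<tau> (\<mu> \<tau>)"
    and phi_1: "\<And>\<tau> x. \<tau>\<^sub>1 < \<tau> \<Longrightarrow>
      \<phi> \<tau> 1 x = sqrt (- \<mu> \<tau> 1) * cosh (sqrt (- \<mu> \<tau> 1) * x)
        - \<tau> * sinh (sqrt (- \<mu> \<tau> 1) * x) * tanh (\<tau> * x)"
    and phi_j: "\<And>\<tau> j x. 0 < \<tau> \<Longrightarrow> 2 \<le> j \<Longrightarrow> x \<in> {-1..1} \<Longrightarrow>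
      \<phi> \<tau> j x = sqrt (\<mu> \<tau> j / \<tau>\<^sup>2 + (tanh (\<tau> * x))\<^sup>2) *
        sin (sqrt (\<mu> \<tau> j) * x + arctan (\<tau> * tanh (\<tau> * x) / sqrt (\<mu> \<tau> j)) + pi / 2 * real j)"
  shows "converges_C_loc UNIV (\<lambda>\<tau> y. 1 / \<tau> * \<phi> \<tau> 1 (y / \<tau>)) (\<lambda>y. 1 / cosh y) at_top
    \<and> (\<forall>j\<ge>2. converges_C_loc ({-1..<0} \<union> {0<..1}) (\<lambda>\<tau> x. \<phi> \<tau> j x) (phi_bar j) at_top)"
proof (intro conjI allI impI)
  have large: "\<forall>\<^sub>F \<tau>::real in at_top. 0 < \<tau> \<and> 2 \<le> \<tau> * tanh \<tau>"
    using eventually_gt_at_top filterlim_tau_tanh_tau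
    by (simp add: eventually_conj_iff filterlim_at_top)
  {
    have "\<forall>\<^sub>F \<tau> in at_top. \<tau> * tanh \<tau> / 2 \<le> sqrt (- \<mu> \<tau> 1) \<and>
        \<tau> * tanh \<tau> * tanh (sqrt (- \<mu> \<tau> 1)) = sqrt (- \<mu> \<tau> 1)"
      using large
    proof eventually_elim
      case (elim \<tau>)
      then obtain b where b: "\<mu> \<tau> 1 = - b\<^sup>2" "\<tau> * tanh \<tau> / 2 \<le> b" "\<tau> * tanh \<tau> * tanh b = b"
        using eigenvalues_of_large_tau(1)[of \<tau> "\<mu> \<tau>"] eigenvalues by blast
      then have "sqrt (- \<mu> \<tau> 1) = b" using elim by simp
      with b show ?case by simp
    qed
    then show "converges_C_loc UNIV (\<lambda>\<tau> y. 1 / \<tau> * \<phi> \<tau> 1 (y / \<tau>)) (\<lambda>y. 1 / cosh y) at_top"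
    proof (intro phi_1_limit[where b="\<lambda>\<tau>. sqrt (- \<mu> \<tau> 1)"])
      show "\<forall>\<^sub>F \<tau> in at_top. \<forall>x. \<phi> \<tau> 1 x = sqrt (- \<mu> \<tau> 1) * cosh (sqrt (- \<mu> \<tau> 1) * x)
          - \<tau> * sinh (sqrt (- \<mu> \<tau> 1) * x) * tanh (\<tau> * x)"
        using eventually_gt_at_top[of \<tau>\<^sub>1] by eventually_elim (use phi_1 in blast)
    qed (auto elim: eventually_mono)
  }
  fix j :: nat assume j: "2 \<le> j"
  define \<kappa> where "\<kappa> = pi / 2 * (real j - 1)"
  have \<kappa>: "0 < \<kappa>" using j by (simp add: \<kappa>_def)
  have root: "\<forall>\<^sub>F \<tau> in at_top. \<kappa> < sqrt (\<mu> \<tau> j) \<and> (sqrt (\<mu> \<tau> j))\<^sup>2 = \<mu> \<tau> j \<and>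
      sqrt (\<mu> \<tau> j) = \<kappa> + arctan (sqrt (\<mu> \<tau> j) / (\<tau> * tanh \<tau>))"
    using large
  proof eventually_elim
    case (elim \<tau>)
    then obtain k where k: "\<kappa> < k" "\<mu> \<tau> j = k\<^sup>2" "k - arctan (k / (\<tau> * tanh \<tau>)) = \<kappa>"
      using eigenvalues_of_large_tau(2)[of \<tau> "\<mu> \<tau>" j] eigenvalues j unfolding \<kappa>_def by blast
    then have "sqrt (\<mu> \<tau> j) = k" using \<kappa> by simp
    with k show ?case by simp
  qed
  have "((\<lambda>\<tau>. sqrt (\<mu> \<tau> j)) \<longlongrightarrow> \<kappa>) at_top"
  proof (rule tendsto_sandwich)
    show "\<forall>\<^sub>F \<tau> in at_top. \<kappa> \<le> sqrt (\<mu> \<tau> j)"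
      using root by eventually_elim simp
    \<comment> \<open>a first crude bound by \<open>\<kappa> + \<pi> / 2\<close> inside the arctangent makes the arctangent small\<close>
    show "\<forall>\<^sub>F \<tau> in at_top. sqrt (\<mu> \<tau> j) \<le> \<kappa> + arctan ((\<kappa> + pi / 2) / (\<tau> * tanh \<tau>))"
      using root large
    proof eventually_elim
      case (elim \<tau>)
      have "sqrt (\<mu> \<tau> j) \<le> \<kappa> + pi / 2"
        using elim arctan_ubound[of "sqrt (\<mu> \<tau> j) / (\<tau> * tanh \<tau>)"] by linarith
      then have "arctan (sqrt (\<mu> \<tau> j) / (\<tau> * tanh \<tau>)) \<le> arctan ((\<kappa> + pi / 2) / (\<tau> * tanh \<tau>))"
        using elim by (simp add: arctan_le_iff divide_right_mono)
      then show ?case using elim by linarith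
    qed
    have "((\<lambda>\<tau>. \<kappa> + arctan ((\<kappa> + pi / 2) / (\<tau> * tanh \<tau>))) \<longlongrightarrow> \<kappa> + arctan 0) at_top"
      by (intro tendsto_intros real_tendsto_divide_at_top[OF tendsto_const filterlim_tau_tanh_tau])
    then show "((\<lambda>\<tau>. \<kappa> + arctan ((\<kappa> + pi / 2) / (\<tau> * tanh \<tau>))) \<longlongrightarrow> \<kappa>) at_top" by simp
  qed simp
  moreover have "\<forall>\<^sub>F \<tau> in at_top. \<forall>x\<in>{-1..1}. \<phi> \<tau> j x =
      sqrt ((sqrt (\<mu> \<tau> j))\<^sup>2 / \<tau>\<^sup>2 + (tanh (\<tau> * x))\<^sup>2) *
      sin (sqrt (\<mu> \<tau> j) * x + arctan (\<tau> * tanh (\<tau> * x) / sqrt (\<mu> \<tau> j)) + pi / 2 * real j)"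
    using root eventually_gt_at_top[of 0] by eventually_elim (use phi_j[OF _ j] in simp)
  ultimately show "converges_C_loc ({-1..<0} \<union> {0<..1}) (\<lambda>\<tau> x. \<phi> \<tau> j x) (phi_bar j) at_top"
    using j unfolding \<kappa>_def by (intro phi_j_limit)
qed

end
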